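(* If $G$ is a quasi-threshold graph, then $\overrightarrow{\chi}(G)=\omega(G)-1$, and $\overrightarrow{\chi}(G)$ can be computed in linear time.
   Context: An orientation $D$ of a graph $G$ replaces each edge by exactly one of its two possible arcs; $d^-_D(v)$ is the indegree of $v$. $D$ is proper if adjacent vertices have distinct indegrees; a $k$-orientation has maximum indegree at most $k$. $\overrightarrow{\chi}(G)$ is the minimum $k$ such that $G$ admits a proper $k$-orientation; $\omega(G)$ is the clique number. A quasi-threshold graph is a graph that is $K_1$ or is obtained by a finite sequence of the operations: disjoint union of two quasi-threshold graphs, and join of a new vertex with a quasi-threshold graph (the join adds all edges between the new vertex and the graph). *)

theory Defs
  imports "HOL-Library.Ramsey"
begin

text \<open>A graph is given by its vertex set \<open>V\<close> and its set \<open>E\<close> of two-element edges \<open>{u, v}\<close>.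
  \<open>clique\<close> is the notion from \<^theory>\<open>HOL-Library.Ramsey\<close>.\<close>

definition clique_number :: "'a set \<Rightarrow> 'a set set \<Rightarrow> nat" where
  "clique_number V E = Max (card ` {K. K \<subseteq> V \<and> clique K E})"

inductive quasi_threshold :: "'a set \<Rightarrow> 'a set set \<Rightarrow> bool" where
  K1: "quasi_threshold {v} {}"
| disjoint_union:
    "\<lbrakk>quasi_threshold V1 E1; quasi_threshold V2 E2; V1 \<inter> V2 = {}\<rbrakk>
      \<Longrightarrow> quasi_threshold (V1 \<union> V2) (E1 \<union> E2)"
| join_vertex:
    "\<lbrakk>quasi_threshold V E; v \<notin> V\<rbrakk>
      \<Longrightarrow> quasi_threshold (insert v V) (E \<union> {{v, u} |u. u \<in> V})"

definition orientation :: "'a set set \<Rightarrow> ('a \<times> 'a) set \<Rightarrow> bool" where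
  "orientation E D \<longleftrightarrow>
     (\<forall>u v. (u, v) \<in> D \<longrightarrow> {u, v} \<in> E) \<and>
     (\<forall>u v. {u, v} \<in> E \<longrightarrow> ((u, v) \<in> D) \<noteq> ((v, u) \<in> D))"

definition indegree :: "('a \<times> 'a) set \<Rightarrow> 'a \<Rightarrow> nat" where
  "indegree D v = card {u. (u, v) \<in> D}"

definition proper :: "'a set set \<Rightarrow> ('a \<times> 'a) set \<Rightarrow> bool" where
  "proper E D \<longleftrightarrow> (\<forall>u v. {u, v} \<in> E \<longrightarrow> indegree D u \<noteq> indegree D v)"

definition proper_orientation_number :: "'a set \<Rightarrow> 'a set set \<Rightarrow> nat" where
  "proper_orientation_number V E =
     (LEAST k. \<exists>D. orientation E D \<and> proper E D \<and> (\<forall>v\<in>V. indegree D v \<le> k))"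


text \<open>Linear time refers to a word RAM: finitely many registers are used by a program, the
  memory is addressed indirectly through registers, every instruction costs one step, and
  words have \<open>O(log N)\<close> bits for inputs of size \<open>N\<close>. There is no multiplication.
  A program halts when the program counter leaves it.\<close>

datatype instr =
    LOADI nat nat      \<comment> \<open>\<open>r\<^sub>i := k\<close>\<close>
  | ADD nat nat nat    \<comment> \<open>\<open>r\<^sub>i := r\<^sub>j + r\<^sub>k\<close>\<close>
  | SUB nat nat nat    \<comment> \<open>\<open>r\<^sub>i := r\<^sub>j - r\<^sub>k\<close>, truncated at \<open>0\<close>\<close>
  | LOAD nat nat       \<comment> \<open>\<open>r\<^sub>i := mem[r\<^sub>j]\<close>\<close>
  | STORE nat nat      \<comment> \<open>\<open>mem[r\<^sub>i] := r\<^sub>j\<close>\<close>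
  | JMP nat            \<comment> \<open>absolute jump\<close>
  | JMPLESS nat nat nat  \<comment> \<open>jump to the third argument if \<open>r\<^sub>i < r\<^sub>j\<close>\<close>

record config =
  pc :: nat
  reg :: "nat \<Rightarrow> nat"
  mem :: "nat \<Rightarrow> nat"

fun exec :: "instr \<Rightarrow> config \<Rightarrow> config" where
  "exec (LOADI i k) s = s\<lparr>pc := pc s + 1, reg := (reg s)(i := k)\<rparr>"
| "exec (ADD i j k) s = s\<lparr>pc := pc s + 1, reg := (reg s)(i := reg s j + reg s k)\<rparr>"
| "exec (SUB i j k) s = s\<lparr>pc := pc s + 1, reg := (reg s)(i := reg s j - reg s k)\<rparr>"
| "exec (LOAD i j) s = s\<lparr>pc := pc s + 1, reg := (reg s)(i := mem s (reg s j))\<rparr>"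
| "exec (STORE i j) s = s\<lparr>pc := pc s + 1, mem := (mem s)(reg s i := reg s j)\<rparr>"
| "exec (JMP l) s = s\<lparr>pc := l\<rparr>"
| "exec (JMPLESS i j l) s = s\<lparr>pc := (if reg s i < reg s j then l else pc s + 1)\<rparr>"

definition halted :: "instr list \<Rightarrow> config \<Rightarrow> bool" where
  "halted P s \<longleftrightarrow> length P \<le> pc s"

definition step :: "instr list \<Rightarrow> config \<Rightarrow> config" where
  "step P s = (if halted P s then s else exec (P ! pc s) s)"

definition initial :: "nat list \<Rightarrow> config" where
  "initial xs = \<lparr>pc = 0, reg = (\<lambda>_. 0), mem = (\<lambda>a. if a < length xs then xs ! a else 0)\<rparr>"

definition run :: "instr list \<Rightarrow> nat list \<Rightarrow> nat \<Rightarrow> config" where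
  "run P xs t = (step P ^^ t) (initial xs)"

text \<open>On input \<open>xs\<close> the program \<open>P\<close> halts within \<open>T\<close> steps with the result \<open>y\<close> in register
  \<open>0\<close>, and no register or memory cell ever holds a number larger than \<open>W\<close>.\<close>

definition outputs_within :: "instr list \<Rightarrow> nat list \<Rightarrow> nat \<Rightarrow> nat \<Rightarrow> nat \<Rightarrow> bool" where
  "outputs_within P xs y T W \<longleftrightarrow>
     (\<exists>t\<le>T. halted P (run P xs t) \<and> reg (run P xs t) 0 = y \<and>
        (\<forall>s\<le>t. \<forall>i. reg (run P xs s) i \<le> W \<and> mem (run P xs s) i \<le> W))"

text \<open>Input graphs have vertices \<open>0, \<dots>, n - 1\<close> and are given by adjacency lists, with the
  neighbours of each vertex in arbitrary order. In memory the lists are stored one after the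
  other, preceded by \<open>n\<close> and by an array of \<open>n + 1\<close> offsets: the list of \<open>v\<close> occupies the
  positions from offset \<open>v\<close> up to, but excluding, offset \<open>v + 1\<close> of the concatenation.\<close>

definition adjacency_lists :: "nat \<Rightarrow> nat set set \<Rightarrow> nat list list \<Rightarrow> bool" where
  "adjacency_lists n E adj \<longleftrightarrow>
     length adj = n \<and>
     (\<forall>v<n. distinct (adj ! v) \<and> set (adj ! v) = {u. {v, u} \<in> E})"

definition encode :: "nat list list \<Rightarrow> nat list" where
  "encode adj =
     length adj # map (\<lambda>v. length (concat (take v adj))) [0..<length adj + 1] @ concat adj"

text \<open>The graph parameter \<open>f\<close> is computable in time \<open>O(n + m)\<close> on the graphs of the class \<open>C\<close>,
  where \<open>n\<close> and \<open>m\<close> are the numbers of vertices and edges. The program may assume that its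
  input belongs to \<open>C\<close>. The word bound \<open>(n + m + 1) ^ c\<close> expresses \<open>O(log (n + m))\<close> bits.\<close>

definition computable_in_linear_time ::
  "(nat set \<Rightarrow> nat set set \<Rightarrow> bool) \<Rightarrow> (nat set \<Rightarrow> nat set set \<Rightarrow> nat) \<Rightarrow> bool" where
  "computable_in_linear_time C f \<longleftrightarrow>
     (\<exists>P c. \<forall>n E adj. C {..<n} E \<longrightarrow> adjacency_lists n E adj \<longrightarrow>
        outputs_within P (encode adj) (f {..<n} E)
          (c * (n + card E)) ((n + card E + 1) ^ c))"

end

theory Submission
  imports Defs
begin

text \<open>Orienting every join from the new vertex to the old graph raises all old indegrees by one,
  so a quasi-threshold graph has a proper orientation whose maximum indegree is one less than the
  size of some clique. Conversely, the vertices of a clique have distinct indegrees.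

  For the linear-time bound, the closed neighbourhoods of adjacent vertices are nested. Hence a
  vertex \<open>v\<close> together with its neighbours of degree at least \<open>deg v\<close> is a clique, and a maximum
  clique is of this form for its vertex of least degree. So \<open>\<omega> - 1\<close> is the maximum over \<open>v\<close> of the
  number of such neighbours, which a single pass over the adjacency lists determines.\<close>

section \<open>Quasi-threshold graphs\<close>

lemma quasi_threshold_wf:
  assumes "quasi_threshold V E"
  shows "finite V" "V \<noteq> {}" "\<And>e. e \<in> E \<Longrightarrow> e \<subseteq> V \<and> card e = 2"
  using assms
proof (induction)
  case (join_vertex V E v)
  { case 1 then show ?case using join_vertex by auto next
    case 2 then show ?case by auto next
    case 3 then show ?case using join_vertex by (fastforce simp: card_insert_if) }
qed auto

lemma quasi_threshold_edge:
  assumes "quasi_threshold V E" "{u, v} \<in> E"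
  shows "u \<in> V" "v \<in> V" "u \<noteq> v"
  using quasi_threshold_wf(3)[OF assms] by auto

lemma quasi_threshold_finite_edges:
  assumes "quasi_threshold V E"
  shows "finite E"
proof (rule finite_subset)
  show "E \<subseteq> Pow V" using quasi_threshold_wf(3)[OF assms] by auto
  show "finite (Pow V)" using quasi_threshold_wf(1)[OF assms] by simp
qed

lemma clique_number_attained:
  assumes "finite V"
  obtains K where "K \<subseteq> V" "clique K E" "card K = clique_number V E"
proof -
  let ?C = "{K. K \<subseteq> V \<and> clique K E}"
  have "finite ?C" using assms by simp
  moreover have "{} \<in> ?C" by (simp add: clique_def)
  ultimately have "Max (card ` ?C) \<in> card ` ?C" by (intro Max_in) auto
  then show thesis using that unfolding clique_number_def by auto
qed

lemma clique_number_ge: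
  assumes "finite V" "K \<subseteq> V" "clique K E"
  shows "card K \<le> clique_number V E"
  unfolding clique_number_def using assms by (intro Max_ge) auto

section \<open>Proper orientations and their relation to cliques\<close>

lemma orientation_subset:
  assumes "orientation E D" "(u, v) \<in> D"
  shows "{u, v} \<in> E"
  using assms by (auto simp: orientation_def)

text \<open>The clique \<open>K\<close> belongs to the induction claim because its size certifies
  the indegree bound: a disjoint union keeps the larger of the two cliques, and a join raises both
  the size of \<open>K\<close> and all old indegrees by one.\<close>

lemma quasi_threshold_orientation:
  assumes "quasi_threshold V E"
  shows "\<exists>D K. orientation E D \<and> proper E D \<and> K \<subseteq> V \<and> clique K E \<and>
           (\<forall>v\<in>V. indegree D v < card K)"
  using assms
proof (induction)
  case (K1 v)
  show ?case
    by (rule exI[of _ "{}"], rule exI[of _ "{v}"])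
      (auto simp: orientation_def proper_def clique_def indegree_def)
next
  case (disjoint_union V1 E1 V2 E2)
  obtain D1 K1 where 1: "orientation E1 D1" "proper E1 D1" "K1 \<subseteq> V1" "clique K1 E1"
    "\<And>v. v \<in> V1 \<Longrightarrow> indegree D1 v < card K1" using disjoint_union.IH by blast
  obtain D2 K2 where 2: "orientation E2 D2" "proper E2 D2" "K2 \<subseteq> V2" "clique K2 E2"
    "\<And>v. v \<in> V2 \<Longrightarrow> indegree D2 v < card K2" using disjoint_union.IH by blast
  note e1 = quasi_threshold_edge[OF disjoint_union.hyps(1)]
  note e2 = quasi_threshold_edge[OF disjoint_union.hyps(2)]
  note d1 = e1[OF orientation_subset[OF 1(1)]]
  note d2 = e2[OF orientation_subset[OF 2(1)]]
  let ?D = "D1 \<union> D2"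
  have disj: "\<And>x. x \<in> V1 \<Longrightarrow> x \<in> V2 \<Longrightarrow> False" using disjoint_union.hyps by blast
  have i1: "indegree ?D v = indegree D1 v" if "v \<in> V1" for v
    unfolding indegree_def using d2 disj that by (intro arg_cong[of _ _ card]) blast
  have i2: "indegree ?D v = indegree D2 v" if "v \<in> V2" for v
    unfolding indegree_def using d1 disj that by (intro arg_cong[of _ _ card]) blast
  have o: "orientation (E1 \<union> E2) ?D"
    unfolding orientation_def
  proof (intro conjI allI impI)
    fix u v assume "(u, v) \<in> ?D"
    then show "{u, v} \<in> E1 \<union> E2" using orientation_subset[OF 1(1)] orientation_subset[OF 2(1)] by blast
  next
    fix u v assume "{u, v} \<in> E1 \<union> E2"
    then consider "{u, v} \<in> E1" | "{u, v} \<in> E2" by blast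
    then show "((u, v) \<in> ?D) \<noteq> ((v, u) \<in> ?D)"
    proof cases
      case 1
      with \<open>orientation E1 D1\<close> have "((u, v) \<in> D1) \<noteq> ((v, u) \<in> D1)"
        unfolding orientation_def by blast
      then show ?thesis using d2 disj e1[OF 1] by blast
    next
      case 2
      with \<open>orientation E2 D2\<close> have "((u, v) \<in> D2) \<noteq> ((v, u) \<in> D2)"
        unfolding orientation_def by blast
      then show ?thesis using d1 disj e2[OF 2] by blast
    qed
  qed
  have p: "proper (E1 \<union> E2) ?D"
    unfolding proper_def
  proof (intro allI impI)
    fix u v assume "{u, v} \<in> E1 \<union> E2"
    then show "indegree ?D u \<noteq> indegree ?D v"
    proof
      assume "{u, v} \<in> E1"
      then show ?thesis using i1 e1[of u v] 1(2) unfolding proper_def by metis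
    next
      assume "{u, v} \<in> E2"
      then show ?thesis using i2 e2[of u v] 2(2) unfolding proper_def by metis
    qed
  qed
  define K where "K = (if card K1 \<le> card K2 then K2 else K1)"
  have "K \<subseteq> V1 \<union> V2" "clique K (E1 \<union> E2)"
    using 1(3,4) 2(3,4) by (auto simp: K_def clique_def)
  moreover have "indegree ?D v < card K" if "v \<in> V1 \<union> V2" for v
    using that i1 i2 1(5)[of v] 2(5)[of v] by (auto simp: K_def)
  ultimately show ?case using o p by blast
next
  case (join_vertex V E v)
  obtain D K where D: "orientation E D" "proper E D" "K \<subseteq> V" "clique K E"
    "\<And>u. u \<in> V \<Longrightarrow> indegree D u < card K" using join_vertex.IH by blast
  note e = quasi_threshold_edge[OF join_vertex.hyps(1)]
  note d = e[OF orientation_subset[OF D(1)]]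
  note fin = quasi_threshold_wf(1)[OF join_vertex.hyps(1)]
  \<comment> \<open>All new arcs leave \<open>v\<close>. So \<open>v\<close> gets indegree 0 and
    every other vertex at least 1, which settles the new edges; on old edges both indegrees grow by
    the same amount and stay distinct.\<close>
  let ?D = "D \<union> {v} \<times> V" and ?E = "E \<union> {{v, u} |u. u \<in> V}"
  have iv: "indegree ?D v = 0"
  proof -
    have "{x. (x, v) \<in> ?D} = {}" using d(2)[of _ v] join_vertex.hyps(2) by blast
    then show ?thesis by (simp only: indegree_def card.empty)
  qed
  have iu: "indegree ?D u = Suc (indegree D u)" if "u \<in> V" for u
  proof -
    have eq: "{x. (x, u) \<in> ?D} = insert v {x. (x, u) \<in> D}" using that by auto
    have "finite {x. (x, u) \<in> D}" using d(1) by (intro finite_subset[OF _ fin]) blast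
    moreover have "v \<notin> {x. (x, u) \<in> D}" using d(1) join_vertex.hyps(2) by blast
    ultimately show ?thesis unfolding indegree_def eq by simp
  qed
  have cases: "{x, y} \<in> E \<and> x \<in> V \<and> y \<in> V \<or> x = v \<and> y \<in> V \<or> y = v \<and> x \<in> V"
    if "{x, y} \<in> ?E" for x y
    using that e[of x y] by (auto simp: doubleton_eq_iff)
  have o: "orientation ?E ?D"
    unfolding orientation_def
  proof (intro conjI allI impI)
    fix x y assume "(x, y) \<in> ?D"
    then show "{x, y} \<in> ?E" using orientation_subset[OF D(1)] by blast
  next
    fix x y assume "{x, y} \<in> ?E"
    then consider "{x, y} \<in> E" "x \<in> V" "y \<in> V" | "x = v" "y \<in> V" | "y = v" "x \<in> V"
      using cases by blast
    then show "((x, y) \<in> ?D) \<noteq> ((y, x) \<in> ?D)"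
    proof cases
      case 1
      with D(1) have "((x, y) \<in> D) \<noteq> ((y, x) \<in> D)" unfolding orientation_def by blast
      then show ?thesis using 1 join_vertex.hyps(2) by blast
    qed (use d join_vertex.hyps(2) in blast)+
  qed
  have p: "proper ?E ?D"
    unfolding proper_def
  proof (intro allI impI)
    fix x y assume "{x, y} \<in> ?E"
    then consider "{x, y} \<in> E" "x \<in> V" "y \<in> V" | "x = v" "y \<in> V" | "y = v" "x \<in> V"
      using cases by blast
    then show "indegree ?D x \<noteq> indegree ?D y"
      by cases (use iu iv D(2) in \<open>auto simp: proper_def\<close>)
  qed
  have "finite K" "v \<notin> K" using D(3) fin join_vertex.hyps(2) by (auto intro: finite_subset)
  then have "card (insert v K) = Suc (card K)" by simp
  then have "indegree ?D u < card (insert v K)" if "u \<in> insert v V" for u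
    using that iu iv D(5) by auto
  moreover have "insert v K \<subseteq> insert v V" "clique (insert v K) ?E"
    using D(3,4) by (auto simp: clique_def insert_commute)
  ultimately show ?case using o p by blast
qed

text \<open>Pigeonhole: the indegrees of the vertices of \<open>K\<close> are pairwise distinct
  members of \<open>{..k}\<close>.\<close>

lemma clique_card_le_indegree_bound:
  assumes "proper E D" "clique K E" "\<And>v. v \<in> K \<Longrightarrow> indegree D v \<le> k"
  shows "card K \<le> Suc k"
proof -
  have "inj_on (indegree D) K"
    using assms(1,2) unfolding proper_def clique_def inj_on_def by blast
  moreover have "indegree D ` K \<subseteq> {..k}" using assms(3) by auto
  ultimately show ?thesis using card_inj_on_le[of "indegree D" K "{..k}"] by simp
qed

lemma proper_orientation_number_quasi_threshold:
  assumes qt: "quasi_threshold V E"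
  shows "Suc (proper_orientation_number V E) = clique_number V E"
proof -
  note fin = quasi_threshold_wf(1)[OF qt]
  let ?P = "\<lambda>k. \<exists>D. orientation E D \<and> proper E D \<and> (\<forall>v\<in>V. indegree D v \<le> k)"
  obtain D K where D: "orientation E D" "proper E D" "K \<subseteq> V" "clique K E"
    "\<And>v. v \<in> V \<Longrightarrow> indegree D v < card K" using quasi_threshold_orientation[OF qt] by blast
  \<comment> \<open>\<open>V\<close> is nonempty and \<open>card K\<close> strictly exceeds an
    indegree, so the truncated difference \<open>card K - 1\<close> is a true predecessor.\<close>
  have pos: "card K > 0" using D(5) quasi_threshold_wf(2)[OF qt] by fastforce
  have k: "?P (card K - 1)" using D by fastforce
  have "proper_orientation_number V E \<le> card K - 1"
    unfolding proper_orientation_number_def by (rule Least_le) (rule k)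
  then have le: "Suc (proper_orientation_number V E) \<le> clique_number V E"
    using clique_number_ge[OF fin D(3,4)] pos by linarith
  have "?P (proper_orientation_number V E)"
    unfolding proper_orientation_number_def by (rule LeastI) (rule k)
  then obtain D' where D': "proper E D'" "\<And>v. v \<in> V \<Longrightarrow> indegree D' v \<le> proper_orientation_number V E"
    by blast
  obtain K' where K': "K' \<subseteq> V" "clique K' E" "card K' = clique_number V E"
    using clique_number_attained[OF fin] .
  have "card K' \<le> Suc (proper_orientation_number V E)"
    using clique_card_le_indegree_bound[OF D'(1) K'(2)] D'(2) K'(1) by blast
  then show ?thesis using le K'(3) by simp
qed

section \<open>The clique number in terms of degrees\<close>

definition neighbours :: "'a set set \<Rightarrow> 'a \<Rightarrow> 'a set" where
  "neighbours E v = {u. {v, u} \<in> E}"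

text \<open>A disjoint union changes no neighbourhood of either part. The closed neighbourhood of a
  join vertex is the whole new vertex set, and those of the old vertices gain exactly the join
  vertex, so old inclusions survive.\<close>

lemma quasi_threshold_nested:
  assumes "quasi_threshold V E" "{u, v} \<in> E"
  shows "insert u (neighbours E u) \<subseteq> insert v (neighbours E v) \<or>
         insert v (neighbours E v) \<subseteq> insert u (neighbours E u)"
  using assms
proof (induction arbitrary: u v)
  case (disjoint_union V1 E1 V2 E2)
  note e1 = quasi_threshold_edge[OF disjoint_union.hyps(1)]
  note e2 = quasi_threshold_edge[OF disjoint_union.hyps(2)]
  have n1: "neighbours (E1 \<union> E2) x = neighbours E1 x" if "x \<in> V1" for x
    using that e2(1) disjoint_union.hyps(3) by (fastforce simp: neighbours_def)
  have n2: "neighbours (E1 \<union> E2) x = neighbours E2 x" if "x \<in> V2" for x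
    using that e1(1) disjoint_union.hyps(3) by (fastforce simp: neighbours_def)
  from disjoint_union.prems show ?case
  proof
    assume "{u, v} \<in> E1"
    then show ?thesis using disjoint_union.IH(1) e1[of u v] n1 by metis
  next
    assume "{u, v} \<in> E2"
    then show ?thesis using disjoint_union.IH(2) e2[of u v] n2 by metis
  qed
next
  case (join_vertex V E w)
  let ?E = "E \<union> {{w, u} |u. u \<in> V}"
  note e = quasi_threshold_edge[OF join_vertex.hyps(1)]
  have nw: "neighbours ?E w = V"
    using e join_vertex.hyps(2) by (auto simp: neighbours_def doubleton_eq_iff)
  have nu: "neighbours ?E x = insert w (neighbours E x)" if "x \<in> V" for x
    using that join_vertex.hyps(2) by (auto simp: neighbours_def doubleton_eq_iff)
  have sub: "neighbours E x \<subseteq> V" for x using e by (auto simp: neighbours_def)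
  from join_vertex.prems consider "{u, v} \<in> E" "u \<in> V" "v \<in> V" | "u = w" "v \<in> V" | "v = w" "u \<in> V"
    using e[of u v] by (auto simp: doubleton_eq_iff)
  then show ?case
  proof cases
    case 1
    then show ?thesis using join_vertex.IH[OF 1(1)] nu[of u] nu[of v] by auto
  qed (use nw nu[of u] nu[of v] sub[of u] sub[of v] in blast)+
qed auto

text \<open>The inequality is non-strict so that adjacent vertices of equal degree count for one
  another; all vertices of a maximum clique may have the same degree.\<close>

definition dominating_neighbours :: "'a set set \<Rightarrow> 'a \<Rightarrow> 'a set" where
  "dominating_neighbours E v =
     {u \<in> neighbours E v. card (neighbours E v) \<le> card (neighbours E u)}"

text \<open>The closed neighbourhood of a dominating neighbour contains that of \<open>v\<close>,
  and therefore all other dominating neighbours.\<close>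

lemma clique_dominating_neighbours:
  assumes qt: "quasi_threshold V E"
  shows "clique (insert v (dominating_neighbours E v)) E"
proof -
  note e = quasi_threshold_edge[OF qt]
  have fin: "finite (neighbours E x)" for x
    using e by (intro finite_subset[OF _ quasi_threshold_wf(1)[OF qt]]) (auto simp: neighbours_def)
  have sub: "insert v (neighbours E v) \<subseteq> insert u (neighbours E u)"
    if u: "u \<in> dominating_neighbours E v" for u
  proof -
    have uv: "{u, v} \<in> E" "card (neighbours E v) \<le> card (neighbours E u)"
      using u by (auto simp: dominating_neighbours_def neighbours_def insert_commute)
    have "x \<notin> neighbours E x" for x using e(3)[of x x] by (auto simp: neighbours_def)
    then have "card (insert v (neighbours E v)) \<le> card (insert u (neighbours E u))"
      using uv(2) fin by simp
    \<comment> \<open>Nestedness leaves two possible inclusions. In the reverse one, the comparison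
      of cardinalities forces the two finite sets to be equal.\<close>
    then show ?thesis
      using quasi_threshold_nested[OF qt uv(1)] fin by (metis card_seteq finite.insertI order_refl)
  qed
  show ?thesis
    unfolding clique_def
  proof (intro ballI impI)
    fix x y assume xy: "x \<in> insert v (dominating_neighbours E v)"
      "y \<in> insert v (dominating_neighbours E v)" "x \<noteq> y"
    have dn: "dominating_neighbours E v \<subseteq> neighbours E v" by (auto simp: dominating_neighbours_def)
    show "{x, y} \<in> E"
    proof (cases "x = v")
      case True
      then show ?thesis using xy dn by (auto simp: neighbours_def)
    next
      case False
      then have "y \<in> insert x (neighbours E x)" using sub[of x] xy dn by blast
      then show ?thesis using xy by (auto simp: neighbours_def)
    qed
  qed
qed

text \<open>The successor accounts for \<open>v\<close> itself. The \<open>0\<close> under the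
  maximum matches \<open>best\<close> below, whose value before any vertex is processed is the
  initial content of register 0.\<close>

lemma clique_number_dominating_neighbours:
  assumes qt: "quasi_threshold V E"
  shows "clique_number V E = Suc (Max (insert 0 ((\<lambda>v. card (dominating_neighbours E v)) ` V)))"
    (is "_ = Suc (Max (insert 0 ?A))")
proof (rule antisym)
  note fin = quasi_threshold_wf(1)[OF qt]
  note e = quasi_threshold_edge[OF qt]
  have sub: "dominating_neighbours E v \<subseteq> V - {v}" for v
    using e(2,3)[of v] by (auto simp: dominating_neighbours_def neighbours_def)
  then have fdn: "finite (dominating_neighbours E v)" for v using fin by (meson finite_Diff finite_subset)
  obtain K where K: "K \<subseteq> V" "clique K E" "card K = clique_number V E"
    using clique_number_attained[OF fin] .
  have fK: "finite K" using K(1) fin finite_subset by blast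
  show "clique_number V E \<le> Suc (Max (insert 0 ?A))"
  proof (cases "K = {}")
    case False
    \<comment> \<open>For a vertex of least degree in a maximum clique, every other member of the
      clique is a dominating neighbour.\<close>
    define v where "v = arg_min_on (\<lambda>v. card (neighbours E v)) K"
    have v: "v \<in> K" "\<And>u. u \<in> K \<Longrightarrow> card (neighbours E v) \<le> card (neighbours E u)"
      using arg_min_if_finite[OF fK False] arg_min_least[OF fK False] unfolding v_def by auto
    have "K - {v} \<subseteq> dominating_neighbours E v"
      using v K(2) by (auto simp: dominating_neighbours_def neighbours_def clique_def)
    then have "card (K - {v}) \<le> card (dominating_neighbours E v)" using card_mono fdn by blast
    also have "\<dots> \<le> Max (insert 0 ?A)" using v(1) K(1) fin by (intro Max_ge) auto
    finally show ?thesis using v(1) K(3) fK by simp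
  qed (use K(3) in simp)
  have "Suc (card (dominating_neighbours E v)) \<le> clique_number V E" if "v \<in> V" for v
  proof -
    have "card (insert v (dominating_neighbours E v)) \<le> clique_number V E"
      using clique_number_ge[OF fin _ clique_dominating_neighbours[OF qt]] sub that by blast
    then show ?thesis using sub[of v] fdn by (metis Diff_iff card_insert_disjoint insertI1 subsetD)
  qed
  moreover from this have "1 \<le> clique_number V E" using quasi_threshold_wf(2)[OF qt] by fastforce
  ultimately have "\<forall>x \<in> insert 0 ?A. x \<le> clique_number V E - 1" by fastforce
  then have "Max (insert 0 ?A) \<le> clique_number V E - 1" using fin by (subst Max_le_iff) auto
  then show "Suc (Max (insert 0 ?A)) \<le> clique_number V E"
    using \<open>1 \<le> clique_number V E\<close> by simp
qed

text \<open>Handshaking: the sum counts ordered pairs \<open>(v, u)\<close> whose underlying set is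
  an edge, and each edge yields at most two such pairs.\<close>

lemma sum_degrees_le:
  assumes "finite V" "finite E" "\<And>e. e \<in> E \<Longrightarrow> card e = 2"
  shows "(\<Sum>v\<in>V. card (neighbours E v)) \<le> 2 * card E"
proof -
  have arcs: "finite {(v, u). {v, u} = e} \<and> card {(v, u). {v, u} = e} \<le> 2" if "e \<in> E" for e
  proof -
    obtain a b where "e = {a, b}" using assms(3)[OF \<open>e \<in> E\<close>] by (auto simp: card_2_iff)
    then have sub: "{(v, u). {v, u} = e} \<subseteq> set [(a, b), (b, a)]" by (auto simp: doubleton_eq_iff)
    have "card {(v, u). {v, u} = e} \<le> card (set [(a, b), (b, a)])" using sub by (rule card_mono[rotated]) simp
    also have "\<dots> \<le> 2" using card_length[of "[(a, b), (b, a)]"] by simp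
    finally show ?thesis using sub finite_subset by blast
  qed
  have eq: "(SIGMA v:UNIV. neighbours E v) = (\<Union>e\<in>E. {(v, u). {v, u} = e})"
    by (auto simp: neighbours_def)
  have fin: "finite (SIGMA v:UNIV. neighbours E v)"
    unfolding eq using assms(2) arcs by blast
  \<comment> \<open>\<open>neighbours E v\<close> lies in the second projection of the finite set of
    all ordered pairs.\<close>
  then have "finite (neighbours E v)" for v
    by (rule finite_subset[rotated, OF finite_imageI[of _ snd]]) force
  then have "(\<Sum>v\<in>V. card (neighbours E v)) = card (SIGMA v:V. neighbours E v)"
    using assms(1) by simp
  also have "\<dots> \<le> card (SIGMA v:UNIV. neighbours E v)" using fin by (intro card_mono) auto
  also have "\<dots> \<le> (\<Sum>e\<in>E. card {(v, u). {v, u} = e})"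
    unfolding eq using assms(2) by (rule card_UN_le)
  also have "\<dots> \<le> (\<Sum>e\<in>E. 2)" using arcs by (intro sum_mono) blast
  finally show ?thesis by simp
qed

section \<open>Bounded runs of the machine\<close>

definition bounded_config :: "nat \<Rightarrow> config \<Rightarrow> bool" where
  "bounded_config W s \<longleftrightarrow> (\<forall>i. reg s i \<le> W) \<and> (\<forall>i. mem s i \<le> W)"

text \<open>\<open>T\<close> is only an upper bound on the number of steps, as
  \<open>reaches_refl\<close> admits every \<open>T\<close>. Both end configurations and all those
  between them are bounded by \<open>W\<close>.\<close>

inductive reaches :: "instr list \<Rightarrow> nat \<Rightarrow> nat \<Rightarrow> config \<Rightarrow> config \<Rightarrow> bool" for P W where
  reaches_refl: "bounded_config W s \<Longrightarrow> reaches P W T s s"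
| reaches_step: "bounded_config W s \<Longrightarrow> reaches P W T (step P s) s' \<Longrightarrow> reaches P W (Suc T) s s'"

lemma reaches_weaken: "reaches P W T s s' \<Longrightarrow> T \<le> T' \<Longrightarrow> reaches P W T' s s'"
proof (induction arbitrary: T' rule: reaches.induct)
  case (reaches_step s T s')
  then obtain T'' where "T' = Suc T''" by (cases T') auto
  then show ?case using reaches_step by (auto intro: reaches.intros)
qed (rule reaches_refl)

lemma reaches_trans:
  "reaches P W T s s' \<Longrightarrow> reaches P W T' s' s'' \<Longrightarrow> reaches P W (T + T') s s''"
proof (induction rule: reaches.induct)
  case (reaches_refl s T)
  then show ?case using reaches_weaken[of P W T' s s'' "T + T'"] by simp
next
  case (reaches_step s T s')
  then show ?case using reaches.reaches_step[of W s P "T + T'" s''] by simp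
qed

lemma reaches_run:
  "reaches P W T s s' \<Longrightarrow>
     \<exists>t\<le>T. (step P ^^ t) s = s' \<and> (\<forall>k\<le>t. bounded_config W ((step P ^^ k) s))"
proof (induction rule: reaches.induct)
  case (reaches_refl s T)
  then show ?case by (intro exI[of _ 0]) auto
next
  case (reaches_step s T s')
  then obtain t where t: "t \<le> T" "(step P ^^ t) (step P s) = s'"
    "\<And>k. k \<le> t \<Longrightarrow> bounded_config W ((step P ^^ k) (step P s))" by blast
  have "bounded_config W ((step P ^^ k) s)" if "k \<le> Suc t" for k
    using that t(3) reaches_step.hyps(1) by (cases k) (auto simp: funpow_swap1)
  then show ?case using t by (intro exI[of _ "Suc t"]) (auto simp: funpow_swap1)
qed

lemma outputs_within_reaches:
  assumes "reaches P W T (initial xs) s" "halted P s" "reg s 0 = y"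
  shows "outputs_within P xs y T W"
proof -
  obtain t where "t \<le> T" "(step P ^^ t) (initial xs) = s"
    "\<forall>k\<le>t. bounded_config W ((step P ^^ k) (initial xs))"
    using reaches_run[OF assms(1)] by blast
  then show ?thesis
    using assms(2,3) unfolding outputs_within_def run_def bounded_config_def by auto
qed

lemma outputs_within_weaken:
  assumes "outputs_within P xs y T W" "T \<le> T'"
  shows "outputs_within P xs y T' W"
proof -
  obtain t where "t \<le> T" and t: "halted P (run P xs t) \<and> reg (run P xs t) 0 = y \<and>
      (\<forall>s\<le>t. \<forall>i. reg (run P xs s) i \<le> W \<and> mem (run P xs s) i \<le> W)"
    using assms(1) unfolding outputs_within_def by blast
  then have "t \<le> T'" using assms(2) by simp
  then show ?thesis using t unfolding outputs_within_def by blast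
qed

section \<open>The program\<close>

text \<open>Register 0 holds the maximum found so far, 1 the number of vertices, 2 the number of vertices
  already started, 3 the constant 1, 4 the address of the next entry of the concatenated lists,
  5 the degree of the current vertex, 6 the number of its neighbours already visited, 8 how many of
  these have at least its degree; 7, 9, 10 and 11 are temporary.\<close>

definition prog :: "instr list" where
  "prog = [
     LOADI 3 1, LOAD 1 0, ADD 4 1 3, ADD 4 4 3,
     \<comment> \<open>4: next vertex\<close>
     JMPLESS 2 1 6, JMP 28,
     ADD 2 2 3, LOAD 5 2, ADD 9 2 3, LOAD 7 9, SUB 5 7 5, LOADI 8 0, LOADI 6 0,
     \<comment> \<open>13: next neighbour\<close>
     JMPLESS 6 5 17,
     SUB 9 8 0, ADD 0 0 9, JMP 4,
     LOAD 9 4, ADD 4 4 3, ADD 9 9 3, LOAD 10 9, ADD 9 9 3, LOAD 11 9, SUB 10 11 10,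
     ADD 6 6 3, JMPLESS 10 5 13, ADD 8 8 3, JMP 13]"

lemma length_prog: "length prog = 28"
  by (simp add: prog_def)

lemma prog_nth:
  "prog ! 0 = LOADI 3 1" "prog ! 1 = LOAD 1 0" "prog ! 2 = ADD 4 1 3" "prog ! 3 = ADD 4 4 3"
  "prog ! 4 = JMPLESS 2 1 6" "prog ! 5 = JMP 28" "prog ! 6 = ADD 2 2 3" "prog ! 7 = LOAD 5 2"
  "prog ! 8 = ADD 9 2 3" "prog ! 9 = LOAD 7 9" "prog ! 10 = SUB 5 7 5" "prog ! 11 = LOADI 8 0"
  "prog ! 12 = LOADI 6 0" "prog ! 13 = JMPLESS 6 5 17" "prog ! 14 = SUB 9 8 0"
  "prog ! 15 = ADD 0 0 9" "prog ! 16 = JMP 4" "prog ! 17 = LOAD 9 4" "prog ! 18 = ADD 4 4 3"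
  "prog ! 19 = ADD 9 9 3" "prog ! 20 = LOAD 10 9" "prog ! 21 = ADD 9 9 3" "prog ! 22 = LOAD 11 9"
  "prog ! 23 = SUB 10 11 10" "prog ! 24 = ADD 6 6 3" "prog ! 25 = JMPLESS 10 5 13"
  "prog ! 26 = ADD 8 8 3" "prog ! 27 = JMP 13"
  by (simp_all add: prog_def)

lemma step_prog:
  "p < 28 \<Longrightarrow> step prog \<lparr>pc = p, reg = r, mem = m\<rparr> = exec (prog ! p) \<lparr>pc = p, reg = r, mem = m\<rparr>"
  by (simp add: step_def halted_def length_prog)

lemma bounded_config_simps:
  "bounded_config W \<lparr>pc = p, reg = r, mem = m\<rparr> \<longleftrightarrow> (\<forall>i. r i \<le> W) \<and> (\<forall>i. m i \<le> W)"
  by (simp add: bounded_config_def)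

text \<open>\<open>W\<close> is at least the length of the encoding, because the scanning pointer in
  register 4 ends just past its last cell. The condition on entries makes every stored vertex a
  valid index into the offset array.\<close>

locale adjacency_input =
  fixes adj :: "nat list list" and W :: nat
  assumes entries: "\<And>v u. v < length adj \<Longrightarrow> u \<in> set (adj ! v) \<Longrightarrow> u < length adj"
    and W: "length adj + 2 + length (concat adj) \<le> W"
begin

section \<open>The encoded graph in memory and the quantities the program maintains\<close>

definition offset :: "nat \<Rightarrow> nat" where
  "offset v = length (concat (take v adj))"

text \<open>The program contains no \<open>STORE\<close>, so this one memory occurs in every
  configuration of the run.\<close>

definition memory :: "nat \<Rightarrow> nat" where
  "memory = mem (initial (encode adj))"

text \<open>The dominating vertex is the second argument: \<open>u\<close> has at least the degree
  of \<open>v\<close>. In this order \<open>dominates v\<close> serves as a filter on the list of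
  \<open>v\<close>.\<close>

definition dominates :: "nat \<Rightarrow> nat \<Rightarrow> bool" where
  "dominates v u \<longleftrightarrow> length (adj ! v) \<le> length (adj ! u)"

definition count :: "nat \<Rightarrow> nat \<Rightarrow> nat" where
  "count v i = length (filter (dominates v) (take i (adj ! v)))"

definition best :: "nat \<Rightarrow> nat" where
  "best k = Max (insert 0 ((\<lambda>v. count v (length (adj ! v))) ` {..<k}))"

lemma concat_split:
  assumes "v < length adj"
  shows "concat adj = concat (take v adj) @ adj ! v @ concat (drop (Suc v) adj)"
  using arg_cong[OF id_take_nth_drop[OF assms], of concat] by simp

lemma offset_0: "offset 0 = 0"
  by (simp add: offset_def)

lemma offset_Suc: "v < length adj \<Longrightarrow> offset (Suc v) = offset v + length (adj ! v)"
  by (simp add: offset_def take_Suc_conv_app_nth)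

lemma offset_le: "offset v \<le> length (concat adj)"
  by (metis append_take_drop_id concat_append length_append le_add1 offset_def)

lemma length_adj_le: "v < length adj \<Longrightarrow> length (adj ! v) \<le> length (concat adj)"
  using offset_Suc[of v] offset_le[of "Suc v"] by simp

lemma memory_0: "memory 0 = length adj"
  by (simp add: memory_def initial_def encode_def)

lemma memory_offset: "v \<le> length adj \<Longrightarrow> memory (Suc v) = offset v"
  by (simp add: memory_def initial_def encode_def offset_def nth_append del: upt_Suc)

text \<open>The concatenated lists start at address \<open>length adj + 2\<close>, behind the vertex
  count and the \<open>length adj + 1\<close> offsets.\<close>

lemma memory_entry:
  assumes "v < length adj" "i < length (adj ! v)"
  shows "memory (length adj + 2 + offset v + i) = adj ! v ! i"
proof -
  have "offset v + i < length (concat adj)"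
    using assms offset_Suc[of v] offset_le[of "Suc v"] by simp
  moreover have "concat adj ! (offset v + i) = adj ! v ! i"
    unfolding concat_split[OF assms(1)] using assms(2) by (simp add: offset_def nth_append)
  ultimately show ?thesis
    by (simp add: memory_def initial_def encode_def nth_append del: upt_Suc)
qed

lemma memory_le: "memory a \<le> W"
proof -
  have "x \<le> W" if x: "x \<in> set (encode adj)" for x
  proof -
    consider "x = length adj" | v where "x = offset v" | "x \<in> set (concat adj)"
      using x by (auto simp: encode_def offset_def simp del: upt_Suc)
    then show ?thesis
    proof cases
      case (2 v)
      then show ?thesis using W offset_le[of v] by linarith
    next
      case 3
      then obtain ys where "ys \<in> set adj" "x \<in> set ys" by auto
      then obtain v where "v < length adj" "x \<in> set (adj ! v)" by (metis in_set_conv_nth)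
      then show ?thesis using entries W by fastforce
    qed (use W in linarith)
  qed
  then show ?thesis by (simp add: memory_def initial_def)
qed

lemma count_Suc:
  "i < length (adj ! v) \<Longrightarrow> count v (Suc i) = count v i + (if dominates v (adj ! v ! i) then 1 else 0)"
  by (simp add: count_def take_Suc_conv_app_nth)

lemma count_le: "count v i \<le> length (adj ! v)"
  unfolding count_def by (rule order_trans[OF length_filter_le]) simp

lemma best_0: "best 0 = 0"
  by (simp add: best_def)

lemma best_Suc: "best (Suc k) = max (best k) (count k (length (adj ! k)))"
proof -
  have "insert 0 ((\<lambda>v. count v (length (adj ! v))) ` {..<Suc k}) =
      insert (count k (length (adj ! k))) (insert 0 ((\<lambda>v. count v (length (adj ! v))) ` {..<k}))"
    by (auto simp: lessThan_Suc)
  then show ?thesis unfolding best_def by (simp add: max.commute)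
qed

section \<open>Loop invariants and the running time of the two nested loops\<close>

definition vertex_inv :: "nat \<Rightarrow> (nat \<Rightarrow> nat) \<Rightarrow> bool" where
  "vertex_inv v r \<longleftrightarrow> (\<forall>i. r i \<le> W) \<and> r 0 = best v \<and> r 1 = length adj \<and> r 2 = v \<and> r 3 = 1 \<and>
     r 4 = length adj + 2 + offset v"

text \<open>Register 2 counts started vertices and so already holds \<open>Suc v\<close>, while
  register 0 does not yet include the contribution of \<open>v\<close>.\<close>

definition neighbour_inv :: "nat \<Rightarrow> nat \<Rightarrow> (nat \<Rightarrow> nat) \<Rightarrow> bool" where
  "neighbour_inv v i r \<longleftrightarrow> (\<forall>j. r j \<le> W) \<and> r 0 = best v \<and> r 1 = length adj \<and> r 2 = Suc v \<and>
     r 3 = 1 \<and> r 4 = length adj + 2 + offset v + i \<and> r 5 = length (adj ! v) \<and> r 6 = i \<and>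
     r 8 = count v i"

abbreviation at :: "nat \<Rightarrow> (nat \<Rightarrow> nat) \<Rightarrow> config" where
  "at p r \<equiv> \<lparr>pc = p, reg = r, mem = memory\<rparr>"

text \<open>The next rule drives symbolic execution: applied repeatedly to a goal with a literal time
  bound and a schematic target, it stops when the bound is used up.\<close>

lemma reaches_at_step:
  assumes "\<forall>i. r i \<le> W" "p < 28" "0 < T" "reaches prog W (T - 1) (exec (prog ! p) (at p r)) s"
  shows "reaches prog W T (at p r) s"
proof -
  have "reaches prog W (Suc (T - 1)) (at p r) s"
    using assms memory_le by (intro reaches_step) (simp_all add: step_prog bounded_config_simps)
  then show ?thesis using assms(3) by simp
qed

lemma reaches_at_refl: "\<forall>i. r i \<le> W \<Longrightarrow> reaches prog W T (at p r) (at p r)"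
  using memory_le by (intro reaches_refl) (simp add: bounded_config_simps)

text \<open>A round of the inner loop executes 12 instructions if the visited neighbour is counted,
  and 10 otherwise.\<close>

lemma neighbour_step:
  assumes inv: "neighbour_inv v i r" and v: "v < length adj" and i: "i < length (adj ! v)"
  shows "\<exists>r'. reaches prog W 12 (at 13 r) (at 13 r') \<and> neighbour_inv v (Suc i) r'"
proof -
  define u where "u = adj ! v ! i"
  have u: "u < length adj" using entries[OF v] i by (simp add: u_def)
  \<comment> \<open>Only an opaque name for the pointer is given to the simplifier, so that the
    facts about \<open>memory a\<close> still match during symbolic execution.\<close>
  obtain a where a: "a = length adj + 2 + offset v + i" by blast
  have r: "r 0 = best v" "r (Suc 0) = length adj" "r 2 = Suc v" "r 3 = Suc 0"
    "r 4 = a" "r 5 = length (adj ! v)" "r 6 = i" "r 8 = count v i"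
    and bnd: "\<And>j. r j \<le> W" using inv unfolding neighbour_inv_def a by auto
  \<comment> \<open>The degree of \<open>u\<close> is the difference of two consecutive offsets. It
    is thus found in constant time, without scanning the list of \<open>u\<close>.\<close>
  have m: "memory a = u" "memory (Suc u) = offset u"
    "memory (Suc (Suc u)) = offset u + length (adj ! u)"
    using memory_entry[OF v i] memory_offset[of u] memory_offset[of "Suc u"] u offset_Suc[of u]
    by (simp_all add: u_def a)
  have le: "Suc a \<le> W" "u \<le> W" "Suc u \<le> W" "Suc (Suc u) \<le> W" "offset u \<le> W"
    "offset u + length (adj ! u) \<le> W" "length (adj ! u) \<le> W" "Suc i \<le> W" "Suc (count v i) \<le> W"
    using W offset_Suc[OF v] offset_le[of "Suc v"] i u offset_Suc[OF u] offset_le[of "Suc u"]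
      length_adj_le[OF u] length_adj_le[OF v] count_le[of v i] unfolding a by linarith+
  note cnt = count_Suc[OF i, folded u_def]
  show ?thesis
  proof (cases "dominates v u")
    case False
    then have lt: "length (adj ! u) < length (adj ! v)" by (simp add: dominates_def)
    \<comment> \<open>The jump at position 25 is taken, which skips the increment of register 8 and
      the final jump.\<close>
    have "\<exists>r'. reaches prog W 10 (at 13 r) (at 13 r') \<and> neighbour_inv v (Suc i) r'"
      apply (rule exI, rule conjI)
       apply (rule reaches_at_step, simp add: bnd le, simp, simp, simp add: prog_nth r m i lt)+
       apply (rule reaches_at_refl, simp add: bnd le)
      apply (simp add: neighbour_inv_def bnd le r cnt False a[symmetric, simplified])
      done
    then show ?thesis using reaches_weaken[of prog W 10 _ _ 12] by auto
  next
    case True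
    then have ge: "\<not> length (adj ! u) < length (adj ! v)" by (simp add: dominates_def)
    show ?thesis
      apply (rule exI, rule conjI)
       apply (rule reaches_at_step, simp add: bnd le, simp, simp, simp add: prog_nth r m i ge)+
       apply (rule reaches_at_refl, simp add: bnd le)
      apply (simp add: neighbour_inv_def bnd le r cnt True a[symmetric, simplified])
      done
  qed
qed

lemma neighbour_loop:
  assumes "neighbour_inv v 0 r" "v < length adj" "i \<le> length (adj ! v)"
  shows "\<exists>r'. reaches prog W (12 * i) (at 13 r) (at 13 r') \<and> neighbour_inv v i r'"
  using assms(3)
proof (induction i)
  case 0
  then show ?case using assms(1) reaches_at_refl by (auto simp: neighbour_inv_def)
next
  case (Suc i)
  then obtain r1 where r1: "reaches prog W (12 * i) (at 13 r) (at 13 r1)" "neighbour_inv v i r1"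
    by auto
  obtain r2 where r2: "reaches prog W 12 (at 13 r1) (at 13 r2)" "neighbour_inv v (Suc i) r2"
    using neighbour_step[OF r1(2) assms(2)] Suc.prems by auto
  show ?case using reaches_trans[OF r1(1) r2(1)] r2(2) by (auto simp: add.commute)
qed

lemma vertex_start:
  assumes inv: "vertex_inv v r" and v: "v < length adj"
  shows "\<exists>r'. reaches prog W 8 (at 4 r) (at 13 r') \<and> neighbour_inv v 0 r'"
proof -
  obtain a where a: "a = length adj + 2 + offset v" by blast
  have r: "r 0 = best v" "r (Suc 0) = length adj" "r 2 = v" "r 3 = Suc 0" "r 4 = a"
    and bnd: "\<And>j. r j \<le> W" using inv unfolding vertex_inv_def a by auto
  have m: "memory (Suc v) = offset v" "memory (Suc (Suc v)) = offset v + length (adj ! v)"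
    using memory_offset[of v] memory_offset[of "Suc v"] v offset_Suc[of v] by simp_all
  have le: "Suc v \<le> W" "Suc (Suc v) \<le> W" "offset v \<le> W"
    "offset v + length (adj ! v) \<le> W" "length (adj ! v) \<le> W" "v \<le> W" "0 \<le> W"
    using W offset_Suc[OF v] offset_le[of "Suc v"] v by linarith+
  show ?thesis
    apply (rule exI, rule conjI)
     apply (rule reaches_at_step, simp add: bnd le, simp, simp, simp add: prog_nth r m v)+
     apply (rule reaches_at_refl, simp add: bnd le)
    apply (simp add: neighbour_inv_def bnd le r count_def a[symmetric, simplified])
    done
qed

text \<open>Four instructions: the failing loop test, two that update the maximum, and the jump
  back. Register 4 already points to the next list because the lists are contiguous.\<close>

lemma vertex_finish:
  assumes inv: "neighbour_inv v (length (adj ! v)) r" and v: "v < length adj"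
  shows "\<exists>r'. reaches prog W 4 (at 13 r) (at 4 r') \<and> vertex_inv (Suc v) r'"
proof -
  obtain a where a: "a = length adj + 2 + offset v + length (adj ! v)" by blast
  define b c where "b = best v" and "c = count v (length (adj ! v))"
  have r: "r 0 = b" "r (Suc 0) = length adj" "r 2 = Suc v" "r 3 = Suc 0"
    "r 4 = a" "r 5 = length (adj ! v)" "r 6 = length (adj ! v)" "r 8 = c"
    and bnd: "\<And>j. r j \<le> W" using inv unfolding neighbour_inv_def a b_def c_def by auto
  have "b \<le> W" "c \<le> W" using bnd[of 0] bnd[of 8] r by simp_all
  then have le: "c - b \<le> W" "b + (c - b) \<le> W" by linarith+
  \<comment> \<open>With truncated subtraction, \<open>b + (c - b)\<close> is the maximum of
    \<open>b\<close> and \<open>c\<close>.\<close>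
  have best: "b + (c - b) = best (Suc v)" by (simp add: best_Suc b_def c_def)
  show ?thesis
    apply (rule exI, rule conjI)
     apply (rule reaches_at_step, simp add: bnd le, simp, simp, simp add: prog_nth r)+
     apply (rule reaches_at_refl, simp add: bnd le)
    apply (simp add: vertex_inv_def bnd le r best[symmetric] offset_Suc[OF v] a)
    done
qed

text \<open>Each vertex costs 8 steps to start and 4 to finish, and each list entry at most 12;
  \<open>offset v\<close> is the total number of entries in the first \<open>v\<close>
  lists.\<close>

lemma vertex_loop:
  assumes "vertex_inv 0 r" "v \<le> length adj"
  shows "\<exists>r'. reaches prog W (12 * v + 12 * offset v) (at 4 r) (at 4 r') \<and> vertex_inv v r'"
  using assms(2)
proof (induction v)
  case 0
  then show ?case using assms(1) reaches_at_refl by (auto simp: vertex_inv_def offset_0)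
next
  case (Suc v)
  then have v: "v < length adj" by simp
  obtain r1 where r1: "reaches prog W (12 * v + 12 * offset v) (at 4 r) (at 4 r1)" "vertex_inv v r1"
    using Suc by auto
  obtain r2 where r2: "reaches prog W 8 (at 4 r1) (at 13 r2)" "neighbour_inv v 0 r2"
    using vertex_start[OF r1(2) v] by auto
  obtain r3 where r3: "reaches prog W (12 * length (adj ! v)) (at 13 r2) (at 13 r3)"
    "neighbour_inv v (length (adj ! v)) r3"
    using neighbour_loop[OF r2(2) v order_refl] by auto
  obtain r4 where r4: "reaches prog W 4 (at 13 r3) (at 4 r4)" "vertex_inv (Suc v) r4"
    using vertex_finish[OF r3(2) v] by auto
  have "reaches prog W (12 * Suc v + 12 * offset (Suc v)) (at 4 r) (at 4 r4)"
    using reaches_trans[OF reaches_trans[OF reaches_trans[OF r1(1) r2(1)] r3(1)] r4(1)] v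
    by (elim reaches_weaken) (simp add: offset_Suc)
  then show ?case using r4(2) by blast
qed

text \<open>The constant 6 consists of 4 initial instructions and 2 for leaving the outer loop: the
  failing test and the jump to 28, where the program halts.\<close>

lemma prog_outputs_best:
  "outputs_within prog (encode adj) (best (length adj))
     (6 + 12 * length adj + 12 * length (concat adj)) W"
proof -
  have init: "initial (encode adj) = at 0 (\<lambda>_. 0)" by (simp add: memory_def initial_def)
  have le: "Suc 0 \<le> W" "length adj \<le> W" "Suc (length adj) \<le> W" "Suc (Suc (length adj)) \<le> W"
    using W by linarith+
  have "\<exists>r. reaches prog W 4 (at 0 (\<lambda>_. 0)) (at 4 r) \<and> vertex_inv 0 r"
    apply (rule exI, rule conjI)
     apply (rule reaches_at_step, simp add: le, simp, simp, simp add: prog_nth memory_0 del: One_nat_def)+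
     apply (rule reaches_at_refl, simp add: le)
    apply (simp add: vertex_inv_def le best_0 offset_0)
    done
  then obtain r1 where r1: "reaches prog W 4 (at 0 (\<lambda>_. 0)) (at 4 r1)" "vertex_inv 0 r1" by blast
  obtain r2 where r2: "reaches prog W (12 * length adj + 12 * offset (length adj)) (at 4 r1) (at 4 r2)"
    "vertex_inv (length adj) r2" using vertex_loop[OF r1(2) order_refl] by blast
  have r: "r2 (Suc 0) = length adj" "r2 2 = length adj" "r2 0 = best (length adj)" and bnd: "\<And>j. r2 j \<le> W"
    using r2(2) by (auto simp: vertex_inv_def)
  have "reaches prog W 2 (at 4 r2) (at 28 r2)"
    apply (rule reaches_at_step, simp add: bnd, simp, simp, simp add: prog_nth r)+
    apply (rule reaches_at_refl, simp add: bnd)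
    done
  from reaches_trans[OF reaches_trans[OF r1(1) r2(1)] this]
  have "reaches prog W (6 + 12 * length adj + 12 * length (concat adj)) (at 0 (\<lambda>_. 0)) (at 28 r2)"
    by (rule reaches_weaken) (simp add: offset_def)
  then show ?thesis
    unfolding init[symmetric] by (rule outputs_within_reaches) (simp_all add: halted_def length_prog r)
qed

end

section \<open>Linear time on quasi-threshold graphs\<close>

lemma quasi_threshold_linear_time:
  "computable_in_linear_time quasi_threshold proper_orientation_number"
  unfolding computable_in_linear_time_def
\<comment> \<open>The lists have at most \<open>2 * card E\<close> entries at 12 steps each, which
  gives 24. The remaining \<open>6 + 12 * n\<close> steps are at most \<open>24 * n\<close> because
  \<open>n\<close> is positive.\<close>
proof (rule exI[of _ prog], rule exI[of _ 24], intro allI impI)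
  fix n E adj
  assume qt: "quasi_threshold {..<n} E" and "adjacency_lists n E adj"
  then have n: "length adj = n"
    and adj: "\<And>v. v < n \<Longrightarrow> distinct (adj ! v) \<and> set (adj ! v) = neighbours E v"
    by (auto simp: adjacency_lists_def neighbours_def)
  note e = quasi_threshold_edge[OF qt]
  have pos: "0 < n" using quasi_threshold_wf(2)[OF qt] by auto
  have deg: "length (adj ! v) = card (neighbours E v)" if "v < n" for v
    using adj[OF that] by (metis distinct_card)
  have "length (concat adj) = (\<Sum>v<n. length (adj ! v))"
    by (simp add: length_concat sum_list_sum_nth n atLeast0LessThan)
  also have "\<dots> = (\<Sum>v<n. card (neighbours E v))" using deg by simp
  also have "\<dots> \<le> 2 * card E"
    using quasi_threshold_finite_edges[OF qt] quasi_threshold_wf(3)[OF qt] by (intro sum_degrees_le) auto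
  finally have len: "length (concat adj) \<le> 2 * card E" .
  define x where "x = n + card E + 1"
  have "length adj + 2 + length (concat adj) \<le> 2 * x" using len by (simp add: n x_def)
  \<comment> \<open>A positive \<open>n\<close> gives \<open>2 \<le> x\<close>.\<close>
  also have "\<dots> \<le> x * x" using pos by (simp add: x_def)
  also have "\<dots> = x ^ 2" by (simp add: power2_eq_square)
  also have "\<dots> \<le> x ^ 24" by (intro power_increasing) (simp_all add: x_def)
  finally have W: "length adj + 2 + length (concat adj) \<le> x ^ 24" .
  interpret adjacency_input adj "x ^ 24"
  proof
    fix v u assume "v < length adj" "u \<in> set (adj ! v)"
    then show "u < length adj" using adj e(2)[of v u] by (auto simp: n neighbours_def)
  qed (rule W)
  have "count v (length (adj ! v)) = card (dominating_neighbours E v)" if v: "v < n" for v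
  proof -
    \<comment> \<open>The lists have no repetitions, so the number of entries passing the filter is
      the cardinality of a set of neighbours.\<close>
    have "count v (length (adj ! v)) = card (set (filter (dominates v) (adj ! v)))"
      using adj[OF v] by (simp add: count_def distinct_card[symmetric] del: set_filter)
    also have "set (filter (dominates v) (adj ! v)) = dominating_neighbours E v"
      using adj[OF v] deg v e(2)[of v] by (auto simp: dominating_neighbours_def dominates_def neighbours_def)
    finally show ?thesis .
  qed
  then have "best n = Max (insert 0 ((\<lambda>v. card (dominating_neighbours E v)) ` {..<n}))"
    unfolding best_def by (metis (no_types, lifting) image_cong lessThan_iff)
  then have "best n = proper_orientation_number {..<n} E"
    using clique_number_dominating_neighbours[OF qt] proper_orientation_number_quasi_threshold[OF qt]
    by simp
  moreover have "6 + 12 * length adj + 12 * length (concat adj) \<le> 24 * (n + card E)"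
    using len pos by (simp add: n)
  ultimately show "outputs_within prog (encode adj) (proper_orientation_number {..<n} E)
      (24 * (n + card E)) ((n + card E + 1) ^ 24)"
    using outputs_within_weaken[OF prog_outputs_best] by (simp add: n x_def)
qed

theorem theorem14:
  shows "(\<forall>(V :: 'a set) E. quasi_threshold V E \<longrightarrow>
            int (proper_orientation_number V E) = int (clique_number V E) - 1) \<and>
         computable_in_linear_time quasi_threshold proper_orientation_number"
proof (intro conjI allI impI)
  fix V :: "'a set" and E
  assume "quasi_threshold V E"
  then show "int (proper_orientation_number V E) = int (clique_number V E) - 1"
    using proper_orientation_number_quasi_threshold[of V E] by linarith
qed (rule quasi_threshold_linear_time)

end
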